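(* Let $T \in U' \otimes V' \otimes W'$ and $S \in U \otimes V \otimes W$ be tensors over a field $\mathbb{F}$, and let $A:U\to U'$, $B:V\to V'$, $C:W\to W'$ be linear maps with $T=(A\otimes B\otimes C)S$. Let $C^\perp \subseteq W^\vee$ be the subspace of linear functionals $f\colon W\to\mathbb{F}$ with $(A\otimes B\otimes f)S=0$. For any subspace $C'\subseteq C^\perp$ define \[ A' = \{ u \in U^\vee : (u \otimes B \otimes g)S = 0 \text{ for all } g\in C'\},\qquad B' = \{ v \in V^\vee : (A \otimes v \otimes g)S = 0 \text{ for all } g\in C'\}. \] Then $T\oplus T' \trianglelefteq S$, where $T'=(A'\otimes B'\otimes C')S$.
   Context: $U^\vee$ denotes the dual space of $U$. For $f\in W^\vee$, $(A\otimes B\otimes f)S$ is an element of $U'\otimes V'\otimes\mathbb{F}\cong U'\otimes V'$, and similarly for functionals in other modes. A subspace $X\subseteq U^\vee$ of dimension $k$ is regarded as the linear map $U\to\mathbb{F}^k$, $u\mapsto (f_1(u),\dots,f_k(u))$ for a basis $f_1,\dots,f_k$ of $X$; thus $T'=(A'\otimes B'\otimes C')S$ is a tensor in $\mathbb{F}^{\dim A'}\otimes\mathbb{F}^{\dim B'}\otimes\mathbb{F}^{\dim C'}$, well defined up to isomorphism. $T\oplus T'$ is the direct sum of tensors. A degeneration $T\trianglelefteq S$ means there are linear maps with entries rational functions in an indeterminate $\lambda$ such that applying them to $S$ gives $T+O(\lambda)$ in the Laurent expansion (no negative powers of $\lambda$, constant term $T$). *)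

theory Defs
  imports
    "Jordan_Normal_Form.VS_Connect"
    "HOL-Computational_Algebra.Fraction_Field"
    "HOL-Computational_Algebra.Polynomial_FPS"
    "HOL-Computational_Algebra.Formal_Laurent_Series"
begin

text \<open>
  Finite-dimensional spaces are taken in coordinates, in the conventions of
  \<^theory>\<open>Jordan_Normal_Form.Matrix\<close>: \<open>U = F^u\<close>, linear maps are matrices, and a functional
  on \<open>F^u\<close> is the vector of its values on the standard basis, i.e. an element of
  \<open>carrier_vec u\<close>, acting as the one-row matrix \<open>mat_of_row\<close>. Dimension \<open>0\<close> is allowed.
  A tensor in \<open>F^m1 \<otimes> F^m2 \<otimes> F^m3\<close> is its array of coordinates, extended by \<open>0\<close> outside
  the index range, so that equality of tensors is equality of functions.
\<close>

type_synonym 'a tensor3 = "nat \<Rightarrow> nat \<Rightarrow> nat \<Rightarrow> 'a"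

definition tensors :: "nat \<Rightarrow> nat \<Rightarrow> nat \<Rightarrow> 'a::zero tensor3 set" where
  "tensors m1 m2 m3 = {S. \<forall>i j k. \<not> (i < m1 \<and> j < m2 \<and> k < m3) \<longrightarrow> S i j k = 0}"

definition zero_tensor :: "'a::zero tensor3" where
  "zero_tensor = (\<lambda>i j k. 0)"

text \<open>\<open>(A \<otimes> B \<otimes> C) S\<close>. If \<open>C\<close> has a single row, the result lies in
  \<open>F^m1 \<otimes> F^m2 \<otimes> F^1\<close>, which stands for \<open>F^m1 \<otimes> F^m2\<close>; similarly in the other modes.\<close>

definition tensor_map :: "'a::comm_semiring_0 mat \<Rightarrow> 'a mat \<Rightarrow> 'a mat \<Rightarrow> 'a tensor3 \<Rightarrow> 'a tensor3" where
  "tensor_map A B C S = (\<lambda>i j k.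
     if i < dim_row A \<and> j < dim_row B \<and> k < dim_row C
     then \<Sum>a<dim_col A. \<Sum>b<dim_col B. \<Sum>c<dim_col C.
            A $$ (i, a) * B $$ (j, b) * C $$ (k, c) * S a b c
     else 0)"

text \<open>The direct sum of \<open>T \<in> tensors m1 m2 m3\<close> and \<open>T'\<close>.\<close>

definition tensor_direct_sum ::
  "nat \<Rightarrow> nat \<Rightarrow> nat \<Rightarrow> 'a::zero tensor3 \<Rightarrow> 'a tensor3 \<Rightarrow> 'a tensor3" where
  "tensor_direct_sum m1 m2 m3 T T' = (\<lambda>i j k.
     if i < m1 \<and> j < m2 \<and> k < m3 then T i j k
     else if m1 \<le> i \<and> m2 \<le> j \<and> m3 \<le> k then T' (i - m1) (j - m2) (k - m3)
     else 0)"

text \<open>The Laurent expansion at \<open>\<lambda> = 0\<close> of a rational function in \<open>\<lambda>\<close>.\<close>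

definition laurent_expansion :: "'a::field poly fract \<Rightarrow> 'a fls" where
  "laurent_expansion r = (THE f. \<exists>p q. q \<noteq> 0 \<and> r = Fract p q \<and>
     f = fps_to_fls (fps_of_poly p) / fps_to_fls (fps_of_poly q))"

lemma laurent_expansion_Fract:
  fixes p q :: "'a::field poly"
  assumes "q \<noteq> 0"
  shows "laurent_expansion (Fract p q) = fps_to_fls (fps_of_poly p) / fps_to_fls (fps_of_poly q)"
proof -
  let ?L = "\<lambda>p :: 'a poly. fps_to_fls (fps_of_poly p)"
  have mult: "?L (x * y) = ?L x * ?L y" for x y
    by (simp add: fps_of_poly_mult fls_times_fps_to_fls)
  have nz: "?L x \<noteq> 0" if "x \<noteq> 0" for x
    using that by simp
  have "?L p' / ?L q' = ?L p / ?L q" if "q' \<noteq> 0" "Fract p q = Fract p' q'" for p' q'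
  proof -
    have "p * q' = p' * q"
      using that assms by (simp add: eq_fract)
    then have "?L p * ?L q' = ?L p' * ?L q"
      by (metis mult)
    then show ?thesis
      using nz[OF assms] nz[OF that(1)] by (simp add: frac_eq_eq)
  qed
  then show ?thesis
    unfolding laurent_expansion_def using assms by (intro the_equality) blast+
qed

definition const_ratfun :: "'a::field \<Rightarrow> 'a poly fract" where
  "const_ratfun c = Fract [:c:] 1"

text \<open>\<open>T \<unlhd> S\<close> for \<open>T \<in> F^n1 \<otimes> F^n2 \<otimes> F^n3\<close> and \<open>S \<in> F^m1 \<otimes> F^m2 \<otimes> F^m3\<close>. The last two
  conjuncts say that the transformed tensor is \<open>T + O(\<lambda>)\<close>.\<close>

definition degenerates ::
  "nat \<Rightarrow> nat \<Rightarrow> nat \<Rightarrow> 'a::field tensor3 \<Rightarrow> nat \<Rightarrow> nat \<Rightarrow> nat \<Rightarrow> 'a tensor3 \<Rightarrow> bool" where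
  "degenerates n1 n2 n3 T m1 m2 m3 S \<longleftrightarrow>
     T \<in> tensors n1 n2 n3 \<and> S \<in> tensors m1 m2 m3 \<and>
     (\<exists>L \<in> carrier_mat n1 m1. \<exists>M \<in> carrier_mat n2 m2. \<exists>N \<in> carrier_mat n3 m3.
        \<forall>i < n1. \<forall>j < n2. \<forall>k < n3.
          let r = laurent_expansion (tensor_map L M N (\<lambda>a b c. const_ratfun (S a b c)) i j k)
          in (\<forall>d < 0. fls_nth r d = 0) \<and> fls_nth r 0 = T i j k)"

definition linear_subspace :: "nat \<Rightarrow> 'a::field vec set \<Rightarrow> bool" where
  "linear_subspace n X \<longleftrightarrow> VectorSpace.subspace class_ring X (module_vec TYPE('a) n)"

text \<open>An ordered basis \<open>fs\<close> of a subspace \<open>X\<close> of \<open>F^n\<close>. If \<open>X\<close> consists of functionals,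
  the linear map \<open>x \<mapsto> (f_1(x), \<dots>, f_k(x))\<close> has matrix \<open>mat_of_rows n fs\<close>.\<close>

definition is_basis :: "nat \<Rightarrow> 'a::field vec set \<Rightarrow> 'a vec list \<Rightarrow> bool" where
  "is_basis n X fs \<longleftrightarrow> distinct fs \<and>
     vectorspace.basis class_ring ((module_vec TYPE('a) n)\<lparr>carrier := X\<rparr>) (set fs)"

text \<open>\<open>C\<^sup>\<bottom>\<close>, \<open>A'\<close> and \<open>B'\<close>; the first argument is the dimension of the space the functionals
  are defined on.\<close>

definition C_perp :: "nat \<Rightarrow> 'a::field mat \<Rightarrow> 'a mat \<Rightarrow> 'a tensor3 \<Rightarrow> 'a vec set" where
  "C_perp w A B S = {f \<in> carrier_vec w. tensor_map A B (mat_of_row f) S = zero_tensor}"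

definition A_prime :: "nat \<Rightarrow> 'a::field mat \<Rightarrow> 'a vec set \<Rightarrow> 'a tensor3 \<Rightarrow> 'a vec set" where
  "A_prime u B C' S =
     {x \<in> carrier_vec u. \<forall>g \<in> C'. tensor_map (mat_of_row x) B (mat_of_row g) S = zero_tensor}"

definition B_prime :: "nat \<Rightarrow> 'a::field mat \<Rightarrow> 'a vec set \<Rightarrow> 'a tensor3 \<Rightarrow> 'a vec set" where
  "B_prime v A C' S =
     {y \<in> carrier_vec v. \<forall>g \<in> C'. tensor_map A (mat_of_row y) (mat_of_row g) S = zero_tensor}"

end

theory Submission
  imports Defs
begin

text \<open>
  Stack \<open>A\<close> on \<open>A'\<close>, \<open>B\<close> on \<open>B'\<close> and \<open>C\<close> on \<open>C'\<close>. By the definitions of \<open>C\<^sup>\<bottom>\<close>, \<open>A'\<close> and \<open>B'\<close>, the blocks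
  \<open>(A, B, C')\<close>, \<open>(A', B, C')\<close> and \<open>(A, B', C')\<close> of the resulting tensor vanish. Scaling \<open>A'\<close> and
  \<open>B'\<close> by \<open>\<lambda>\<close> and \<open>C'\<close> by \<open>\<lambda>\<^sup>-\<^sup>2\<close> multiplies both diagonal blocks \<open>T\<close> and \<open>T'\<close> by \<open>1\<close>
  and each of the remaining blocks \<open>(A', B, C)\<close>, \<open>(A, B', C)\<close>, \<open>(A', B', C)\<close> by \<open>\<lambda>\<close> or \<open>\<lambda>\<^sup>2\<close>.
\<close>

section \<open>Entries of transformed tensors and rows of stacked matrices\<close>

lemma tensor_map_in_tensors: "tensor_map A B C S \<in> tensors (dim_row A) (dim_row B) (dim_row C)"
  by (auto simp: tensors_def tensor_map_def)

lemma tensor_direct_sum_in_tensors: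
  assumes "T' \<in> tensors n1 n2 n3"
  shows "tensor_direct_sum m1 m2 m3 T T' \<in> tensors (m1 + n1) (m2 + n2) (m3 + n3)"
  using assms by (auto simp: tensors_def tensor_direct_sum_def less_diff_conv2 add.commute)

text \<open>An entry is a sum involving one row of each factor only. This lets every block of the
  stacked tensor be read off separately, with matrices of different heights.\<close>

lemma tensor_map_row_cong:
  assumes "i < dim_row A" "i' < dim_row A'" "row A i = row A' i'"
    and "j < dim_row B" "j' < dim_row B'" "row B j = row B' j'"
    and "k < dim_row C" "k' < dim_row C'" "row C k = row C' k'"
  shows "tensor_map A B C S i j k = tensor_map A' B' C' S i' j' k'"
proof -
  have entries: "M $$ (l, c) = N $$ (l', c)" if "l < dim_row M" "l' < dim_row N" "row M l = row N l'" "c < dim_col M"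
    for M N :: "'a mat" and l l' c
    using that by (metis index_row(1) index_row(2))
  \<comment> \<open>The row, being a vector, remembers its length, so the summation ranges agree as
    well.\<close>
  have cols: "dim_col M = dim_col N" if "row M l = row N l'" for M N :: "'a mat" and l l'
    using that by (metis index_row(2))
  show ?thesis
    using assms by (auto simp: tensor_map_def cols[OF assms(3), symmetric] cols[OF assms(6), symmetric]
        cols[OF assms(9), symmetric] entries[OF assms(1-3)] entries[OF assms(4-6)]
        entries[OF assms(7-9)] intro!: sum.cong)
qed

lemma row_append_rows:
  assumes "A \<in> carrier_mat m n" "B \<in> carrier_mat p n" "i < m + p"
  shows "row (A @\<^sub>r B) i = (if i < m then row A i else row B (i - m))"
  using assms by (intro eq_vecI) (auto simp: append_rows_def)

lemma row_append_mat_of_rows: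
  assumes "A \<in> carrier_mat m n" "set fs \<subseteq> carrier_vec n" "i < m + length fs"
  shows "row (A @\<^sub>r mat_of_rows n fs) i = (if i < m then row A i else fs ! (i - m))"
proof -
  \<comment> \<open>A row of \<open>mat_of_rows n fs\<close> always has length \<open>n\<close>; it
    is the listed vector itself only if that vector has length \<open>n\<close> too.\<close>
  have "fs ! (i - m) \<in> carrier_vec n" if "\<not> i < m"
    using assms(2,3) that nth_mem[of "i - m" fs] by auto
  then show ?thesis
    using assms by (auto simp: row_append_rows[where p = "length fs"])
qed

section \<open>Bases, and the subspaces of functionals they span\<close>

lemma is_basis_subset:
  assumes "linear_subspace n X" "is_basis n X fs"
  shows "set fs \<subseteq> X"
proof -
  \<comment> \<open>\<open>basis\<close> belongs to the locale \<open>vectorspace\<close>, so its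
    definition is available only once \<open>X\<close> is known to be a vector space.\<close>
  have "vectorspace class_ring ((module_vec TYPE('a) n)\<lparr>carrier := X\<rparr>)"
    using vectorspace.subspace_is_vs[OF vec_vs] assms(1) by (auto simp: linear_subspace_def)
  from vectorspace.basis_def[OF this] show ?thesis
    using assms(2) by (auto simp: is_basis_def)
qed

lemma linear_subspaceI:
  fixes X :: "'a::field vec set"
  assumes "X \<subseteq> carrier_vec n" "0\<^sub>v n \<in> X"
    and "\<And>x y. x \<in> X \<Longrightarrow> y \<in> X \<Longrightarrow> x + y \<in> X"
    and "\<And>c x. x \<in> X \<Longrightarrow> c \<cdot>\<^sub>v x \<in> X"
  shows "linear_subspace n X"
  unfolding linear_subspace_def VectorSpace.subspace_def submodule_def
  using assms vec_vs vec_module by (auto simp: module_vec_simps)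

lemma tensor_map_row_zero1: "tensor_map (mat_of_row (0\<^sub>v n)) B C S = zero_tensor"
  by (auto simp: tensor_map_def zero_tensor_def fun_eq_iff)

lemma tensor_map_row_add1:
  fixes x :: "'a::comm_semiring_0 vec"
  assumes "x \<in> carrier_vec n" "y \<in> carrier_vec n"
  shows "tensor_map (mat_of_row (x + y)) B C S i j k =
    tensor_map (mat_of_row x) B C S i j k + tensor_map (mat_of_row y) B C S i j k"
  using assms by (auto simp: tensor_map_def algebra_simps sum.distrib)

lemma tensor_map_row_smult1:
  fixes x :: "'a::comm_semiring_0 vec"
  shows "tensor_map (mat_of_row (r \<cdot>\<^sub>v x)) B C S i j k = r * tensor_map (mat_of_row x) B C S i j k"
  by (auto simp: tensor_map_def sum_distrib_left mult.assoc)

lemma tensor_map_row_zero2: "tensor_map A (mat_of_row (0\<^sub>v n)) C S = zero_tensor"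
  by (auto simp: tensor_map_def zero_tensor_def fun_eq_iff)

lemma tensor_map_row_add2:
  fixes x :: "'a::comm_semiring_0 vec"
  assumes "x \<in> carrier_vec n" "y \<in> carrier_vec n"
  shows "tensor_map A (mat_of_row (x + y)) C S i j k =
    tensor_map A (mat_of_row x) C S i j k + tensor_map A (mat_of_row y) C S i j k"
  using assms by (auto simp: tensor_map_def algebra_simps sum.distrib)

lemma tensor_map_row_smult2:
  fixes x :: "'a::comm_semiring_0 vec"
  shows "tensor_map A (mat_of_row (r \<cdot>\<^sub>v x)) C S i j k = r * tensor_map A (mat_of_row x) C S i j k"
  by (auto simp: tensor_map_def sum_distrib_left ac_simps)

text \<open>Each \<open>g\<close> in \<open>C'\<close> imposes a linear condition on the functional,
  so this is an intersection of kernels. It makes \<open>is_basis_subset\<close> applicable to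
  \<open>A_prime\<close>.\<close>

lemma linear_subspace_A_prime: "linear_subspace u (A_prime u B C' S)"
  by (rule linear_subspaceI)
    (auto simp: A_prime_def zero_tensor_def fun_eq_iff tensor_map_row_add1 tensor_map_row_smult1
      tensor_map_row_zero1[unfolded zero_tensor_def])

lemma linear_subspace_B_prime: "linear_subspace v (B_prime v A C' S)"
  by (rule linear_subspaceI)
    (auto simp: B_prime_def zero_tensor_def fun_eq_iff tensor_map_row_add2 tensor_map_row_smult2
      tensor_map_row_zero2[unfolded zero_tensor_def])

section \<open>Powers of the indeterminate and their Laurent expansions\<close>

lemma const_ratfun_0 [simp]: "const_ratfun 0 = 0"
  by (simp add: const_ratfun_def Zero_fract_def)

lemma const_ratfun_add: "const_ratfun (x + y) = const_ratfun x + const_ratfun y"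
  by (simp add: const_ratfun_def)

lemma const_ratfun_mult: "const_ratfun (x * y) = const_ratfun x * const_ratfun y"
  by (simp add: const_ratfun_def mult.commute)

lemma const_ratfun_sum: "const_ratfun (sum f I) = (\<Sum>i\<in>I. const_ratfun (f i))"
  by (induction I rule: infinite_finite_induct) (auto simp: const_ratfun_add)

definition ratfun_var :: "'a::field poly fract" where
  "ratfun_var = Fract [:0, 1:] 1"

lemma ratfun_var_nonzero: "ratfun_var \<noteq> 0"
  by (simp add: ratfun_var_def Zero_fract_def eq_fract)

text \<open>With denominator 1, the Laurent expansion is just the numerator, a single
  monomial.\<close>

lemma ratfun_var_power: "ratfun_var ^ n * const_ratfun c = Fract (monom c n) 1"
  by (induction n) (auto simp: ratfun_var_def const_ratfun_def monom_0 monom_Suc mult.assoc)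

lemma laurent_expansion_monomial:
  "fls_nth (laurent_expansion (ratfun_var ^ n * const_ratfun c)) d = (if d = int n then c else 0)"
  by (auto simp: ratfun_var_power laurent_expansion_Fract)

text \<open>This is the product of a diagonal matrix of powers of the indeterminate with the
  constant matrix \<open>A\<close>. Integer exponents allow poles.\<close>

definition scale_rows :: "(nat \<Rightarrow> int) \<Rightarrow> 'a::field mat \<Rightarrow> 'a poly fract mat" where
  "scale_rows e A = mat (dim_row A) (dim_col A) (\<lambda>(i, a). ratfun_var powi e i * const_ratfun (A $$ (i, a)))"

text \<open>By multilinearity the three row factors leave the sum; their exponents add because the
  indeterminate is nonzero.\<close>

lemma tensor_map_scale_rows:
  fixes A :: "'a::field mat"
  assumes "i < dim_row A" "j < dim_row B" "k < dim_row C"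
  shows "tensor_map (scale_rows e A) (scale_rows f B) (scale_rows g C) (\<lambda>a b c. const_ratfun (S a b c)) i j k =
    ratfun_var powi (e i + f j + g k) * const_ratfun (tensor_map A B C S i j k)"
proof -
  have "(ratfun_var :: 'a poly fract) powi (e i + f j + g k) =
      ratfun_var powi e i * ratfun_var powi f j * ratfun_var powi g k"
    by (simp add: power_int_add ratfun_var_nonzero)
  then show ?thesis
    using assms by (auto simp: tensor_map_def scale_rows_def const_ratfun_sum const_ratfun_mult
        sum_distrib_left ac_simps intro!: sum.cong)
qed

text \<open>Reduces a degeneration to bookkeeping of weights: each entry becomes a constant times
  one power of the indeterminate, so entries of negative weight must vanish, those of weight 0
  survive, and those of positive weight are absorbed in the error term.\<close>

lemma degenerates_monomialI:
  fixes e f g :: "nat \<Rightarrow> int"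
  assumes "T \<in> tensors n1 n2 n3" "S \<in> tensors m1 m2 m3"
    and "A \<in> carrier_mat n1 m1" "B \<in> carrier_mat n2 m2" "C \<in> carrier_mat n3 m3"
    and neg: "\<And>i j k. \<lbrakk>i < n1; j < n2; k < n3; e i + f j + g k < 0\<rbrakk> \<Longrightarrow> tensor_map A B C S i j k = 0"
    and T: "\<And>i j k. \<lbrakk>i < n1; j < n2; k < n3\<rbrakk> \<Longrightarrow>
      T i j k = (if e i + f j + g k = 0 then tensor_map A B C S i j k else 0)"
  shows "degenerates n1 n2 n3 T m1 m2 m3 S"
proof -
  define R where
    "R = tensor_map (scale_rows e A) (scale_rows f B) (scale_rows g C) (\<lambda>a b c. const_ratfun (S a b c))"
  have "(\<forall>d<0. fls_nth (laurent_expansion (R i j k)) d = 0) \<and> fls_nth (laurent_expansion (R i j k)) 0 = T i j k"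
    if ijk: "i < n1" "j < n2" "k < n3" for i j k
  proof -
    \<comment> \<open>Only natural exponents have an expansion lemma. If the weight is negative, the
      coefficient is 0 and the exponent 0 serves as a placeholder.\<close>
    obtain n where n: "R i j k = ratfun_var ^ n * const_ratfun (tensor_map A B C S i j k)"
      and n0: "T i j k = (if n = 0 then tensor_map A B C S i j k else 0)"
    proof (cases "e i + f j + g k < 0")
      case True
      then have "tensor_map A B C S i j k = 0"
        using neg ijk by blast
      moreover have "T i j k = 0"
        using True T[OF ijk] by simp
      ultimately show ?thesis
        using that[of 0] assms(3-5) ijk by (simp add: R_def tensor_map_scale_rows)
    next
      case False
      then show ?thesis
        using that[of "nat (e i + f j + g k)"] T[OF ijk] assms(3-5) ijk
        by (simp add: R_def tensor_map_scale_rows power_int_def)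
    qed
    show ?thesis
      unfolding n n0 laurent_expansion_monomial by auto
  qed
  moreover have "scale_rows e A \<in> carrier_mat n1 m1" "scale_rows f B \<in> carrier_mat n2 m2"
    "scale_rows g C \<in> carrier_mat n3 m3"
    using assms(3-5) by (auto simp: scale_rows_def)
  ultimately show ?thesis
    unfolding degenerates_def Let_def R_def using assms(1,2) by blast
qed

section \<open>Blocks of the stacked tensor and their weights\<close>

theorem theorem5p1:
  fixes u v w u' v' w' :: nat
    and S T :: "'a::field tensor3"
    and A B C :: "'a mat"
    and C' :: "'a vec set"
    and as bs cs :: "'a vec list"
  assumes "S \<in> tensors u v w" and "T \<in> tensors u' v' w'"
    and "A \<in> carrier_mat u' u" and "B \<in> carrier_mat v' v" and "C \<in> carrier_mat w' w"
    and "T = tensor_map A B C S"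
    and "linear_subspace w C'" and "C' \<subseteq> C_perp w A B S"
    and "is_basis u (A_prime u B C' S) as"
    and "is_basis v (B_prime v A C' S) bs"
    and "is_basis w C' cs"
  shows "degenerates (u' + length as) (v' + length bs) (w' + length cs)
           (tensor_direct_sum u' v' w' T
             (tensor_map (mat_of_rows u as) (mat_of_rows v bs) (mat_of_rows w cs) S))
           u v w S"
proof -
  have as: "set as \<subseteq> A_prime u B C' S" and bs: "set bs \<subseteq> B_prime v A C' S" and cs: "set cs \<subseteq> C'"
    using assms is_basis_subset linear_subspace_A_prime linear_subspace_B_prime by blast+
  define As Bs Cs where "As = mat_of_rows u as" and "Bs = mat_of_rows v bs" and "Cs = mat_of_rows w cs"
  let ?A = "A @\<^sub>r As" and ?B = "B @\<^sub>r Bs" and ?C = "C @\<^sub>r Cs"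
  let ?R = "tensor_map ?A ?B ?C S"
  have dims: "As \<in> carrier_mat (length as) u" "Bs \<in> carrier_mat (length bs) v" "Cs \<in> carrier_mat (length cs) w"
    by (auto simp: As_def Bs_def Cs_def)
  note carriers = assms(3-5) dims
  note stacked = carrier_append_rows[OF assms(3) dims(1)] carrier_append_rows[OF assms(4) dims(2)]
    carrier_append_rows[OF assms(5) dims(3)]
  note dim_rows = carriers[THEN carrier_matD(1)] stacked[THEN carrier_matD(1)]
  have in_carrier: "set as \<subseteq> carrier_vec u" "set bs \<subseteq> carrier_vec v" "set cs \<subseteq> carrier_vec w"
    using as bs cs assms(8) by (auto simp: A_prime_def B_prime_def C_perp_def)
  note row_A = row_append_mat_of_rows[OF assms(3) in_carrier(1), folded As_def]
    and row_B = row_append_mat_of_rows[OF assms(4) in_carrier(2), folded Bs_def]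
    and row_C = row_append_mat_of_rows[OF assms(5) in_carrier(3), folded Cs_def]
  have ABC: "?R i j k = T i j k" if "i < u'" "j < v'" "k < w'" for i j k
    unfolding assms(6) using that
    by (intro tensor_map_row_cong) (simp_all add: row_A row_B row_C dim_rows)
  have A'B'C': "?R i j k = tensor_map As Bs Cs S (i - u') (j - v') (k - w')"
    if "u' \<le> i" "v' \<le> j" "w' \<le> k" "i < u' + length as" "j < v' + length bs" "k < w' + length cs" for i j k
    using that
    by (intro tensor_map_row_cong)
      (auto simp: row_append_rows[OF assms(3) dims(1)] row_append_rows[OF assms(4) dims(2)]
        row_append_rows[OF assms(5) dims(3)] dim_rows)
  have ABC': "?R i j k = 0" if "i < u'" "j < v'" "w' \<le> k" "k < w' + length cs" for i j k
  proof -
    have "cs ! (k - w') \<in> C'"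
      using cs that by auto
    then have "tensor_map A B (mat_of_row (cs ! (k - w'))) S i j 0 = 0"
      using assms(8) by (auto simp: C_perp_def zero_tensor_def)
    \<comment> \<open>The one-row matrix has 0 as its only row index, hence the last
      argument.\<close>
    moreover have "?R i j k = tensor_map A B (mat_of_row (cs ! (k - w'))) S i j 0"
      using that by (intro tensor_map_row_cong) (simp_all add: row_A row_B row_C dim_rows)
    ultimately show ?thesis
      by simp
  qed
  have A'BC': "?R i j k = 0"
    if "u' \<le> i" "i < u' + length as" "j < v'" "w' \<le> k" "k < w' + length cs" for i j k
  proof -
    have "cs ! (k - w') \<in> C'" "as ! (i - u') \<in> A_prime u B C' S"
      using cs as that by auto
    then have "tensor_map (mat_of_row (as ! (i - u'))) B (mat_of_row (cs ! (k - w'))) S 0 j 0 = 0"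
      by (auto simp: A_prime_def zero_tensor_def)
    moreover have "?R i j k = tensor_map (mat_of_row (as ! (i - u'))) B (mat_of_row (cs ! (k - w'))) S 0 j 0"
      using that by (intro tensor_map_row_cong) (simp_all add: row_A row_B row_C dim_rows)
    ultimately show ?thesis
      by simp
  qed
  have AB'C': "?R i j k = 0"
    if "i < u'" "v' \<le> j" "j < v' + length bs" "w' \<le> k" "k < w' + length cs" for i j k
  proof -
    have "cs ! (k - w') \<in> C'" "bs ! (j - v') \<in> B_prime v A C' S"
      using cs bs that by auto
    then have "tensor_map A (mat_of_row (bs ! (j - v'))) (mat_of_row (cs ! (k - w'))) S i 0 0 = 0"
      by (auto simp: B_prime_def zero_tensor_def)
    moreover have "?R i j k = tensor_map A (mat_of_row (bs ! (j - v'))) (mat_of_row (cs ! (k - w'))) S i 0 0"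
      using that by (intro tensor_map_row_cong) (simp_all add: row_A row_B row_C dim_rows)
    ultimately show ?thesis
      by simp
  qed
  define e f g :: "nat \<Rightarrow> int" where "e i = (if i < u' then 0 else 1)"
    and "f j = (if j < v' then 0 else 1)" and "g k = (if k < w' then 0 else - 2)" for i j k
  show ?thesis
    unfolding As_def[symmetric] Bs_def[symmetric] Cs_def[symmetric]
  proof (rule degenerates_monomialI[where e = e and f = f and g = g, OF _ assms(1) stacked])
    show "tensor_direct_sum u' v' w' T (tensor_map As Bs Cs S)
        \<in> tensors (u' + length as) (v' + length bs) (w' + length cs)"
      using tensor_map_in_tensors[of As Bs Cs S] by (intro tensor_direct_sum_in_tensors) (simp add: dim_rows)
  next
    fix i j k
    assume "i < u' + length as" "j < v' + length bs" "k < w' + length cs" "e i + f j + g k < 0"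
    \<comment> \<open>A negative weight forces \<open>k\<close> into the \<open>C'\<close> block and
      at least one of \<open>i\<close>, \<open>j\<close> into its first block: exactly the three
      vanishing blocks.\<close>
    then show "?R i j k = 0"
      by (auto simp: e_def f_def g_def ABC' A'BC' AB'C' split: if_splits)
  next
    fix i j k
    assume "i < u' + length as" "j < v' + length bs" "k < w' + length cs"
    \<comment> \<open>Weight 0 occurs only for 0 + 0 + 0 and 1 + 1 - 2, which are the two diagonal
      blocks.\<close>
    then show "tensor_direct_sum u' v' w' T (tensor_map As Bs Cs S) i j k =
        (if e i + f j + g k = 0 then ?R i j k else 0)"
      by (auto simp: e_def f_def g_def tensor_direct_sum_def ABC A'B'C')
  qed
qed

end
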